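(* Let $K$ be an algebraically closed field and $A\in\mathcal{A}(m,\Gamma)$. Then the algebra $A$ is a monomial algebra iff $\operatorname{Aut}_K(A)=\mathbb{T}$ iff $\{1,x^\gamma\mid\gamma\in\Gamma\}$ is the canonical basis of the algebra $\overline{A}$.
   Context: $\mathbb{S}(m)$ is the set consisting of the empty set and of all non-empty subsets $\Gamma\subseteq\{2,\ldots,m-2\}$ such that $\Gamma+\Gamma\subseteq\Gamma\cup[m,\infty)$. $\mathcal{A}(m)$ ($m\geq2$) is the set of all $K$-subalgebras $A$ of $K[x]$ such that $x^mK[x]\subset A$ and $x^{m-1}\notin A$. For $A\in\mathcal{A}(m)$, $\Gamma_A\in\mathbb{S}(m)$ is the set of integers $\gamma$ with $1\leq\gamma\leq m-1$ such that $A$ contains an element of the form $x^\gamma+\sum_{j>\gamma}\lambda_jx^j$. $\mathcal{A}(m,\Gamma):=\{A\in\mathcal{A}(m)\mid\Gamma_A=\Gamma\}$. The algebra $\overline{A}:=A/x^mK[x]\subseteq K[x]/x^mK[x]=\bigoplus_{i=0}^{m-1}Kx^i$ has a unique $K$-basis $\{1,f_\gamma\mid\gamma\in\Gamma\}$ (the canonical basis) with $f_\gamma=x^\gamma+\sum_{\delta}\lambda_{\gamma\delta}x^\delta$, $\lambda_{\gamma\delta}\in K$, the sum being over $\delta\notin\Gamma$, $\gamma<\delta\leq m-1$. An algebra $A\in\mathcal{A}(m)$ is a monomial algebra if it admits a $K$-basis consisting of monomials $x^i$. $\mathbb{T}=\{t_\lambda\mid\lambda\in K^\times\}$, $t_\lambda$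 being the automorphism $x\mapsto\lambda x$ of $K[x]$. Every $K$-automorphism of $A\in\mathcal{A}(m)$ is the restriction of a unique $t_\lambda$ with $t_\lambda(A)=A$, so $\operatorname{Aut}_K(A)$ is identified with a subgroup of $\mathbb{T}$. *)

theory Defs
  imports
    "HOL-Computational_Algebra.Computational_Algebra"
    "HOL-Library.FuncSet"
begin

text \<open>The polynomial ring \<open>K[x]\<close> as a \<open>K\<close>-vector space; this gives access to the library notions
  \<open>poly_vs.subspace\<close>, \<open>poly_vs.span\<close> and \<open>poly_vs.independent\<close>.\<close>

interpretation poly_vs: vector_space "smult :: 'a::field \<Rightarrow> 'a poly \<Rightarrow> 'a poly"
  by unfold_locales (simp_all add: smult_add_left smult_add_right)

definition K_basis :: "'a::field poly set \<Rightarrow> 'a poly set \<Rightarrow> bool" where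
  "K_basis B V \<longleftrightarrow> poly_vs.independent B \<and> poly_vs.span B = V"

definition K_subalgebra :: "'a::field poly set \<Rightarrow> bool" where
  "K_subalgebra A \<longleftrightarrow> poly_vs.subspace A \<and> 1 \<in> A \<and> (\<forall>p\<in>A. \<forall>q\<in>A. p * q \<in> A)"

definition algs :: "nat \<Rightarrow> 'a::field poly set set" where
  "algs m = {A. K_subalgebra A \<and> range (\<lambda>p. monom 1 m * p) \<subseteq> A \<and> monom 1 (m - 1) \<notin> A}"

text \<open>\<open>lowest_term \<gamma> p\<close>: \<open>p\<close> has the form \<open>x\<^sup>\<gamma> + (terms of degree > \<gamma>)\<close>.\<close>

definition lowest_term :: "nat \<Rightarrow> 'a::field poly \<Rightarrow> bool" where
  "lowest_term \<gamma> p \<longleftrightarrow> coeff p \<gamma> = 1 \<and> (\<forall>j<\<gamma>. coeff p j = 0)"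

definition gamma_set :: "nat \<Rightarrow> 'a::field poly set \<Rightarrow> nat set" where
  "gamma_set m A = {\<gamma>. 1 \<le> \<gamma> \<and> \<gamma> \<le> m - 1 \<and> (\<exists>p\<in>A. lowest_term \<gamma> p)}"

definition algs_of :: "nat \<Rightarrow> nat set \<Rightarrow> 'a::field poly set set" where
  "algs_of m \<Gamma> = {A \<in> algs m. gamma_set m A = \<Gamma>}"

text \<open>\<open>K[x]/x\<^sup>mK[x]\<close> is identified with the direct sum of the \<open>K x\<^sup>i\<close>, \<open>i < m\<close>, by taking remainders
  modulo \<open>x\<^sup>m\<close>; under this identification \<open>A/x\<^sup>mK[x]\<close> is the following subspace.\<close>

definition alg_bar :: "nat \<Rightarrow> 'a::field poly set \<Rightarrow> 'a poly set" where
  "alg_bar m A = (\<lambda>p. p mod monom 1 m) ` A"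

text \<open>There is exactly one such basis for \<open>A \<in> algs m\<close>, so a predicate is used for
  ``being the canonical basis''.\<close>

definition is_canonical_basis :: "nat \<Rightarrow> 'a::field poly set \<Rightarrow> 'a poly set \<Rightarrow> bool" where
  "is_canonical_basis m A B \<longleftrightarrow>
     K_basis B (alg_bar m A) \<and>
     (\<exists>f l. B = insert 1 (f ` gamma_set m A) \<and>
        (\<forall>\<gamma>\<in>gamma_set m A.
           f \<gamma> = monom 1 \<gamma> + (\<Sum>\<delta>\<in>{\<gamma><..m - 1} - gamma_set m A. monom (l \<gamma> \<delta>) \<delta>)))"

definition monomial_algebra :: "'a::field poly set \<Rightarrow> bool" where
  "monomial_algebra A \<longleftrightarrow> (\<exists>I. K_basis (monom 1 ` I) A)"

text \<open>\<open>K\<close>-algebra automorphisms of \<open>A\<close>; maps on \<open>A\<close> are represented by functions that are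
  \<open>undefined\<close> outside \<open>A\<close>, so that equality of automorphisms is equality of functions.\<close>

definition Aut_K :: "'a::field poly set \<Rightarrow> ('a poly \<Rightarrow> 'a poly) set" where
  "Aut_K A = {\<sigma> \<in> extensional A. bij_betw \<sigma> A A \<and> \<sigma> 1 = 1 \<and>
     (\<forall>p\<in>A. \<forall>q\<in>A. \<sigma> (p + q) = \<sigma> p + \<sigma> q) \<and>
     (\<forall>p\<in>A. \<forall>q\<in>A. \<sigma> (p * q) = \<sigma> p * \<sigma> q) \<and>
     (\<forall>c. \<forall>p\<in>A. \<sigma> (smult c p) = smult c (\<sigma> p))}"

definition t_aut :: "'a::field \<Rightarrow> 'a poly \<Rightarrow> 'a poly" where
  "t_aut c p = pcompose p [:0, c:]"

text \<open>Automorphisms of \<open>A\<close> are identified with elements of the torus \<open>\<T>\<close> by restriction to \<open>A\<close>,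
  so \<open>Aut\<^sub>K(A) = \<T>\<close> means \<open>Aut_K A = (\<lambda>t. restrict t A) ` torus\<close>: the automorphisms of \<open>A\<close> are
  exactly the restrictions of all elements of the torus.\<close>

definition torus :: "('a::field poly \<Rightarrow> 'a poly) set" where
  "torus = {t_aut c |c. c \<noteq> 0}"

text \<open>The set \<open>\<S>(m)\<close>; that \<open>\<Gamma>\<^sub>A\<close> belongs to it is automatic, so it need not be assumed.\<close>

definition gamma_sets :: "nat \<Rightarrow> nat set set" where
  "gamma_sets m = {\<Gamma>. \<Gamma> \<subseteq> {2..m - 2} \<and> (\<forall>a\<in>\<Gamma>. \<forall>b\<in>\<Gamma>. a + b \<in> \<Gamma> \<or> m \<le> a + b)}"

lemma lowest_term_iff: "lowest_term n p \<longleftrightarrow> (\<exists>q. p = monom 1 n * q \<and> coeff q 0 = 1)"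
proof
  assume p: "lowest_term n p"
  then have "monom 1 n dvd p"
    by (simp add: lowest_term_def monom_1_dvd_iff')
  then obtain q where q: "p = monom 1 n * q" by (elim dvdE)
  with p show "\<exists>q. p = monom 1 n * q \<and> coeff q 0 = 1"
    by (auto simp: lowest_term_def coeff_monom_mult)
qed (auto simp: lowest_term_def coeff_monom_mult)

lemma lowest_term_mult:
  fixes p q :: "'a::field poly"
  assumes "lowest_term a p" "lowest_term b q"
  shows "lowest_term (a + b) (p * q)"
proof -
  from assms obtain p' q' where "p = monom 1 a * p'" "coeff p' 0 = 1"
      "q = monom 1 b * q'" "coeff q' 0 = 1"
    by (auto simp: lowest_term_iff)
  moreover have "monom 1 (a + b) = monom 1 a * (monom 1 b :: 'a poly)"
    by (simp add: mult_monom)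
  ultimately have "p * q = monom 1 (a + b) * (p' * q') \<and> coeff (p' * q') 0 = 1"
    by (simp add: coeff_mult_0 mult_ac)
  then show ?thesis unfolding lowest_term_iff by blast
qed

lemma gamma_set_in_gamma_sets:
  assumes m: "2 \<le> m" and A: "A \<in> algs m"
  shows "gamma_set m A \<in> gamma_sets m"
proof -
  have mult: "p * q \<in> A" if "p \<in> A" "q \<in> A" for p q
    using A that by (auto simp: algs_def K_subalgebra_def)
  have one: "1 \<in> A" using A by (auto simp: algs_def K_subalgebra_def)
  have top: "\<not> lowest_term (m - 1) p" if p: "p \<in> A" for p
  proof
    assume "lowest_term (m - 1) p"
    then obtain q where q: "p = monom 1 (m - 1) * q" "coeff q 0 = 1"
      by (auto simp: lowest_term_iff)
    obtain c q' where c: "q = pCons c q'" by (cases q)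
    have "monom 1 (m - 1) * pCons 0 q' = monom 1 m * q'"
      using m by (intro poly_eqI) (auto simp: coeff_monom_mult coeff_pCons split: nat.splits)
    moreover have "q = 1 + pCons 0 q'" using c q(2) by (simp add: one_pCons)
    ultimately have "monom 1 (m - 1) = p - monom 1 m * q'"
      using q(1) by (simp add: algebra_simps)
    moreover have "monom 1 m * q' \<in> A" using A by (auto simp: algs_def)
    ultimately have "monom 1 (m - 1) \<in> A"
      using A p by (auto simp: algs_def K_subalgebra_def intro: poly_vs.subspace_diff)
    with A show False by (auto simp: algs_def)
  qed
  have "\<not> lowest_term 1 p" if p: "p \<in> A" for p
  proof
    assume *: "lowest_term 1 p"
    have "p ^ n \<in> A \<and> lowest_term n (p ^ n)" for n
      by (induction n)
        (use * p one mult lowest_term_mult[OF *] in \<open>auto simp: lowest_term_def[of 0]\<close>)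
    then show False using top by blast
  qed
  then have "\<gamma> \<noteq> 1 \<and> \<gamma> \<noteq> m - 1" if "\<gamma> \<in> gamma_set m A" for \<gamma>
    using that top by (auto simp: gamma_set_def)
  then have "gamma_set m A \<subseteq> {2..m - 2}"
    by (fastforce simp: gamma_set_def)
  moreover have "a + b \<in> gamma_set m A \<or> m \<le> a + b"
    if "a \<in> gamma_set m A" "b \<in> gamma_set m A" for a b
    using that mult lowest_term_mult by (fastforce simp: gamma_set_def)
  ultimately show ?thesis by (auto simp: gamma_sets_def)
qed

end

theory Submission
  imports Defs
begin

text \<open>An automorphism \<open>\<sigma>\<close> of \<open>A\<close> sends \<open>x\<^sup>m, x\<^sup>m\<^sup>+\<^sup>1\<close> to \<open>a, b\<close> with \<open>a\<^sup>m\<^sup>+\<^sup>1 = b\<^sup>m\<close>, so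
  \<open>a = c\<^sup>m\<close> and \<open>b = c\<^sup>m\<^sup>+\<^sup>1\<close> for some polynomial \<open>c\<close>, and \<open>\<sigma>\<close> is the substitution \<open>x \<mapsto> c\<close>.
  Surjectivity forces \<open>c\<close> to have degree 1, and then \<open>c(0) = 0\<close>, since otherwise
  \<open>c\<^sup>m x\<^sup>m\<^sup>-\<^sup>1 \<in> A\<close> would yield \<open>x\<^sup>m\<^sup>-\<^sup>1 \<in> A\<close>. Hence \<open>Aut\<^sub>K(A)\<close> always lies in the torus, and it is all of
  the torus iff \<open>A\<close> is stable under every \<open>x \<mapsto> \<lambda>x\<close>. As \<open>K\<close> is infinite, stability means
  that \<open>A\<close> contains every monomial occurring in one of its elements.\<close>

section \<open>Polynomials over algebraically closed fields\<close>

text \<open>Over a finite field, adding 1 to the product of all \<open>x - a\<close> would give a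
  nonconstant polynomial without a root.\<close>

lemma infinite_UNIV_alg_closed: "infinite (UNIV :: 'a::alg_closed_field set)"
proof
  assume fin: "finite (UNIV :: 'a set)"
  define p where "p = (\<Prod>a\<in>(UNIV :: 'a set). [:- a, 1:])"
  have "degree p = card (UNIV :: 'a set)"
    unfolding p_def by (subst degree_prod_eq_sum_degree) auto
  then have "0 < degree p" using fin by (simp add: card_gt_0_iff)
  then have "0 < degree (p + 1)" by (subst degree_add_eq_left) auto
  then obtain x where x: "poly (p + 1) x = 0" using alg_closed_imp_poly_has_root by blast
  have "poly p x = 0"
    unfolding p_def poly_prod by (rule prod_zero) (use fin in auto)
  with x show False by simp
qed

text \<open>Only 0 and the finitely many roots of \<open>x^i - x^j\<close> must be avoided. Such a
  scalar lets the torus tell two exponents apart.\<close>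

lemma exists_power_neq:
  assumes "i \<noteq> j"
  shows "\<exists>c::'a::alg_closed_field. c \<noteq> 0 \<and> c ^ i \<noteq> c ^ j"
proof -
  let ?p = "monom 1 i - monom 1 j :: 'a poly"
  have "?p \<noteq> 0" using assms by (simp add: monom_eq_iff')
  then have "finite {x. poly ?p x = 0}" by (rule poly_roots_finite)
  then have "finite (insert 0 {x. poly ?p x = 0})" by simp
  then obtain c where "c \<notin> insert 0 {x. poly ?p x = 0}"
    using infinite_UNIV_alg_closed ex_new_if_finite by blast
  then show ?thesis by (auto simp: poly_monom)
qed

text \<open>A root of \<open>p\<close> is a root of \<open>q ^ n\<close>, hence of \<open>q\<close>;
  cancelling the common linear factor on both sides lowers the degree of \<open>p\<close>.\<close>

lemma poly_power_dvd_power_imp_dvd: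
  fixes p q :: "'a::alg_closed_field poly"
  assumes "0 < n" "p \<noteq> 0" "p ^ n dvd q ^ n"
  shows "p dvd q"
  using assms(2,3)
proof (induction "degree p" arbitrary: p q)
  case 0
  then show ?case by (auto simp: is_unit_iff_degree intro: unit_imp_dvd)
next
  case (Suc d)
  then obtain r where "poly p r = 0"
    using alg_closed_imp_poly_has_root[of p] by auto
  then obtain p' where p': "p = [:- r, 1:] * p'"
    by (auto simp: poly_eq_0_iff_dvd elim: dvdE)
  have "[:- r, 1:] dvd q ^ n"
    using Suc.prems(2) p' \<open>0 < n\<close>
    by (metis dvd_power dvd_trans dvd_triv_left)
  then have "poly q r = 0"
    by (simp add: poly_eq_0_iff_dvd[symmetric])
  then obtain q' where q': "q = [:- r, 1:] * q'"
    by (auto simp: poly_eq_0_iff_dvd elim: dvdE)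
  have "p' \<noteq> 0" using p' Suc.prems by auto
  have "degree p = Suc (degree p')"
    using \<open>p' \<noteq> 0\<close> unfolding p' by (subst degree_mult_eq) auto
  moreover have "p' ^ n dvd q' ^ n"
    using Suc.prems(2) unfolding p' q' power_mult_distrib
    by (subst (asm) dvd_mult_cancel_left) auto
  ultimately have "p' dvd q'" using Suc \<open>p' \<noteq> 0\<close> by auto
  then show ?case unfolding p' q' by (rule mult_dvd_mono[OF dvd_refl])
qed

lemma common_root_of_powers:
  fixes p q :: "'a::alg_closed_field poly"
  assumes "p ^ Suc n = q ^ n" "p \<noteq> 0" "0 < n"
  obtains r where "p = r ^ n" "q = r ^ Suc n"
proof -
  \<comment> \<open>This makes the quotient \<open>q / p\<close>, the candidate for the common root,
    a polynomial.\<close>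
  have "p ^ n dvd q ^ n" using assms(1) by (metis dvd_triv_right power_Suc)
  then obtain r where r: "q = p * r"
    using poly_power_dvd_power_imp_dvd[OF assms(3,2)] by (auto elim: dvdE)
  have "p ^ n * p = p ^ n * r ^ n"
    using assms(1) by (simp add: r power_mult_distrib mult_ac)
  then have "p = r ^ n" using assms(2) by simp
  with r that show thesis by (simp add: mult.commute)
qed

section \<open>Monomials\<close>

lemma poly_eq_sum_smult_monom: "p = (\<Sum>i\<le>degree p. smult (coeff p i) (monom (1::'a::field) i))"
  by (simp add: smult_monom poly_as_sum_of_monoms)

lemma pcompose_monom: "pcompose (monom 1 n) q = q ^ n"
  by (induction n) (simp_all add: monom_0 monom_Suc pcompose_pCons pcompose_1)

lemma independent_monoms: "poly_vs.independent (monom (1::'a::field) ` I)"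
  unfolding poly_vs.dependent_explicit
proof clarify
  fix t and u :: "'a poly \<Rightarrow> 'a" and v i
  assume t: "finite t" "t \<subseteq> monom 1 ` I" and sum: "(\<Sum>w\<in>t. smult (u w) w) = 0"
    and v: "v \<in> t" and u: "u v \<noteq> 0"
  from v t obtain i where i: "v = monom 1 i" by auto
  have "u w * coeff w i = (if w = v then u v else 0)" if "w \<in> t" for w
  proof -
    from that t obtain j where "w = monom 1 j" by auto
    then show ?thesis using i by (auto simp: monom_eq_iff')
  qed
  then have "(\<Sum>w\<in>t. u w * coeff w i) = u v"
    using t v by simp
  moreover have "(\<Sum>w\<in>t. u w * coeff w i) = 0"
    using arg_cong[OF sum, of "\<lambda>p. coeff p i"] by (simp add: coeff_sum)
  ultimately show False using u by simp
qed

lemma in_span_monoms: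
  assumes "\<And>i. coeff p i \<noteq> 0 \<Longrightarrow> i \<in> I"
  shows "p \<in> poly_vs.span (monom 1 ` I)"
proof (subst poly_eq_sum_smult_monom, rule poly_vs.span_sum)
  fix i assume "i \<in> {..degree p}"
  show "smult (coeff p i) (monom 1 i) \<in> poly_vs.span (monom 1 ` I)"
    by (cases "coeff p i = 0")
      (auto intro: poly_vs.span_zero poly_vs.span_scale poly_vs.span_base assms)
qed

section \<open>The algebras\<close>

lemma algsD:
  assumes "A \<in> algs m"
  shows algs_subspace: "poly_vs.subspace A"
    and algs_one: "1 \<in> A"
    and algs_mult: "\<And>p q. p \<in> A \<Longrightarrow> q \<in> A \<Longrightarrow> p * q \<in> A"
    and algs_ideal: "\<And>p. monom 1 m * p \<in> A"
    and algs_conductor: "monom 1 (m - 1) \<notin> A"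
  using assms by (auto simp: algs_def K_subalgebra_def)

lemma algs_monom:
  assumes "A \<in> algs m" "m \<le> k"
  shows "monom 1 k \<in> A"
  using algs_ideal[OF assms(1), of "monom 1 (k - m)"] assms(2) by (simp add: mult_monom)

lemma algs_mod_iff:
  assumes "A \<in> algs m"
  shows "p mod monom 1 m \<in> A \<longleftrightarrow> p \<in> A"
proof -
  have "p = monom 1 m * (p div monom 1 m) + p mod monom 1 m" by simp
  then show ?thesis
    using algs_ideal[OF assms, of "p div monom 1 m"] algs_subspace[OF assms]
    by (metis add_diff_cancel_left' poly_vs.subspace_add poly_vs.subspace_diff)
qed

lemma coeff_mod_monom: "coeff (p mod monom (1::'a::field) m) i = (if i < m then coeff p i else 0)"
proof -
  have "p = monom 1 m * (p div monom 1 m) + p mod monom 1 m" by simp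
  then have "coeff p i = coeff (monom 1 m * (p div monom 1 m)) i + coeff (p mod monom 1 m) i"
    by (metis coeff_add)
  moreover have "coeff (p mod monom 1 m) i = 0" if "m \<le> i"
  proof (cases "p mod monom 1 m = 0")
    case False
    then have "degree (p mod monom 1 m) < m"
      using degree_mod_less[of "monom 1 m" p] by (auto simp: degree_monom_eq)
    then show ?thesis using that by (simp add: coeff_eq_0)
  qed simp
  ultimately show ?thesis by (auto simp: coeff_monom_mult)
qed

text \<open>Representing classes by remainders keeps them in \<open>A\<close>, since a remainder
  differs from its polynomial by an element of the ideal of multiples of \<open>x^m\<close>.\<close>

lemma alg_bar_subset:
  assumes "A \<in> algs m"
  shows "alg_bar m A \<subseteq> A"
  using algs_mod_iff[OF assms] by (auto simp: alg_bar_def)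

section \<open>Automorphisms\<close>

lemma Aut_K_D:
  assumes "\<sigma> \<in> Aut_K A"
  shows Aut_K_extensional: "\<sigma> \<in> extensional A"
    and Aut_K_bij: "bij_betw \<sigma> A A"
    and Aut_K_one: "\<sigma> 1 = 1"
    and Aut_K_add: "\<And>p q. p \<in> A \<Longrightarrow> q \<in> A \<Longrightarrow> \<sigma> (p + q) = \<sigma> p + \<sigma> q"
    and Aut_K_mult: "\<And>p q. p \<in> A \<Longrightarrow> q \<in> A \<Longrightarrow> \<sigma> (p * q) = \<sigma> p * \<sigma> q"
    and Aut_K_smult: "\<And>c p. p \<in> A \<Longrightarrow> \<sigma> (smult c p) = smult c (\<sigma> p)"
  using assms by (auto simp: Aut_K_def)

lemma Aut_K_power:
  assumes "A \<in> algs m" "\<sigma> \<in> Aut_K A" "p \<in> A"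
  shows "p ^ n \<in> A \<and> \<sigma> (p ^ n) = \<sigma> p ^ n"
  by (induction n)
    (auto simp: algs_one[OF assms(1)] algs_mult[OF assms(1)] assms(3)
      Aut_K_one[OF assms(2)] Aut_K_mult[OF assms(2)])

lemma Aut_K_sum:
  assumes "A \<in> algs m" "\<sigma> \<in> Aut_K A" "\<And>i. i \<in> S \<Longrightarrow> g i \<in> A"
  shows "\<sigma> (\<Sum>i\<in>S. smult (f i) (g i)) = (\<Sum>i\<in>S. smult (f i) (\<sigma> (g i)))"
  using assms(3)
proof (induction S rule: infinite_finite_induct)
  case (insert i S)
  then have "smult (f i) (g i) \<in> A" "(\<Sum>i\<in>S. smult (f i) (g i)) \<in> A"
    using algs_subspace[OF assms(1)]
    by (auto intro!: poly_vs.subspace_sum poly_vs.subspace_scale)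
  with insert show ?case
    by (simp add: Aut_K_add[OF assms(2)] Aut_K_smult[OF assms(2)])
\<comment> \<open>The empty sum, and the default value 0 of a sum over an infinite set, need
  \<open>\<sigma> 0 = 0\<close>; this comes from scaling 1 by 0.\<close>
qed (use Aut_K_smult[OF assms(2) algs_one[OF assms(1)], of 0] in simp_all)

lemma Aut_K_eq_pcompose:
  fixes A :: "'k::alg_closed_field poly set"
  assumes m: "0 < m" and A: "A \<in> algs m" and \<sigma>: "\<sigma> \<in> Aut_K A"
  obtains c where "\<And>p. p \<in> A \<Longrightarrow> \<sigma> p = pcompose p c"
proof -
  note in_A = algs_monom[OF A]
  have "monom 1 m ^ Suc m = (monom 1 (Suc m) ^ m :: 'k poly)"
    unfolding monom_power by (simp only: power_one mult.commute)
  then have "\<sigma> (monom 1 m) ^ Suc m = \<sigma> (monom 1 (Suc m)) ^ m"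
    using Aut_K_power[OF A \<sigma> in_A, of m "Suc m"] Aut_K_power[OF A \<sigma> in_A, of "Suc m" m]
    by (metis le_SucI order_refl)
  moreover have ne: "\<sigma> (monom 1 m) \<noteq> 0"
  proof
    have "0 \<in> A" by (rule poly_vs.subspace_0[OF algs_subspace[OF A]])
    moreover have "\<sigma> 0 = 0" using Aut_K_smult[OF \<sigma> \<open>0 \<in> A\<close>, of 0] by simp
    moreover assume "\<sigma> (monom 1 m) = 0"
    ultimately have "monom (1::'k) m = 0"
      using Aut_K_bij[OF \<sigma>] in_A[of m] by (metis bij_betw_imp_inj_on inj_onD order_refl)
    then show False by simp
  qed
  ultimately obtain c where c: "\<sigma> (monom 1 m) = c ^ m" "\<sigma> (monom 1 (Suc m)) = c ^ Suc m"
    using m by (rule common_root_of_powers)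
  have "c \<noteq> 0" using c ne m by auto
  have monom: "\<sigma> (monom 1 k) = c ^ k" if "m \<le> k" for k
  proof -
    \<comment> \<open>The factor \<open>x^(mk)\<close> turns \<open>x^k\<close> into a power of
      \<open>x^(m+1)\<close>, so only the two known images are involved.\<close>
    have "monom 1 k * monom 1 m ^ k = (monom 1 (Suc m) ^ k :: 'k poly)"
      by (simp add: monom_power mult_monom)
    then have "\<sigma> (monom 1 k) * (c ^ m) ^ k = (c ^ Suc m) ^ k"
      using Aut_K_mult[OF \<sigma> in_A[OF that], of "monom 1 m ^ k"]
        Aut_K_power[OF A \<sigma> in_A, of m k] Aut_K_power[OF A \<sigma> in_A, of "Suc m" k] c
      by simp
    also have "\<dots> = c ^ k * (c ^ m) ^ k" by (simp add: power_mult_distrib)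
    finally show ?thesis using \<open>c \<noteq> 0\<close> by simp
  qed
  have ideal: "\<sigma> q = pcompose q c" if "monom 1 m dvd q" for q
  proof -
    \<comment> \<open>Only exponents from \<open>m\<close> on occur, and each of these monomials
      lies in \<open>A\<close>, so linearity of \<sigma> applies termwise.\<close>
    have "q = (\<Sum>i\<in>{m..degree q}. smult (coeff q i) (monom 1 i))"
      by (subst poly_eq_sum_smult_monom, rule sum.mono_neutral_right)
        (use that in \<open>auto simp: monom_1_dvd_iff'\<close>)
    then have "\<sigma> q = (\<Sum>i\<in>{m..degree q}. smult (coeff q i) (c ^ i))"
        and "pcompose q c = (\<Sum>i\<in>{m..degree q}. smult (coeff q i) (c ^ i))"
      using Aut_K_sum[OF A \<sigma>, of "{m..degree q}" "monom 1" "coeff q"] in_A monom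
      by (auto simp: pcompose_sum pcompose_smult pcompose_monom dest: arg_cong[of _ _ "\<lambda>p. pcompose p c"])
    then show ?thesis by simp
  qed
  have "\<sigma> p = pcompose p c" if "p \<in> A" for p
  proof -
    \<comment> \<open>The monomials of \<open>p\<close> need not lie in \<open>A\<close>;
      multiplying by \<open>x^m\<close> moves \<open>p\<close> into the ideal, where \<sigma> is
      known.\<close>
    have "\<sigma> p * c ^ m = \<sigma> (p * monom 1 m)"
      using Aut_K_mult[OF \<sigma> that in_A[of m]] c by simp
    also have "\<dots> = pcompose p c * c ^ m"
      by (simp add: ideal pcompose_mult pcompose_monom)
    finally show ?thesis using \<open>c \<noteq> 0\<close> by simp
  qed
  then show thesis by (rule that)
qed

lemma Aut_K_subset_torus:
  fixes A :: "'k::alg_closed_field poly set"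
  assumes m: "0 < m" and A: "A \<in> algs m"
  shows "Aut_K A \<subseteq> (\<lambda>t. restrict t A) ` torus"
proof
  fix \<sigma> assume \<sigma>: "\<sigma> \<in> Aut_K A"
  obtain c where c: "\<And>p. p \<in> A \<Longrightarrow> \<sigma> p = pcompose p c"
    using Aut_K_eq_pcompose[OF m A \<sigma>] by blast
  \<comment> \<open>Degrees multiply under composition; divisibility of both \<open>m\<close> and
    \<open>m + 1\<close> then leaves only degree 1.\<close>
  have "degree c dvd k" if "m \<le> k" for k
  proof -
    have "monom 1 k \<in> \<sigma> ` A"
      using Aut_K_bij[OF \<sigma>] algs_monom[OF A that] by (simp add: bij_betw_def)
    then obtain p where "monom 1 k = pcompose p c" using c by auto
    then have "k = degree p * degree c" by (metis degree_monom_eq degree_pcompose one_neq_zero)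
    then show ?thesis by simp
  qed
  from this[of m] this[of "Suc m"] have "degree c = 1"
    by (metis Suc_eq_plus1 dvd_add_right_iff le_Suc_eq nat_dvd_1_iff_1 order_refl)
  moreover obtain \<mu> r where "c = pCons \<mu> r" by (cases c)
  ultimately have "degree r = 0" "r \<noteq> 0" by (auto split: if_splits)
  then obtain \<nu> where \<mu>\<nu>: "c = [:\<mu>, \<nu>:]" "\<nu> \<noteq> 0"
    using \<open>c = pCons \<mu> r\<close> by (auto elim: degree_eq_zeroE)
  have "\<mu> = 0"
  proof (rule ccontr)
    assume "\<mu> \<noteq> 0"
    \<comment> \<open>Composing \<open>x^(m-1)\<close> with the inverse of the affine substitution
      \<open>c\<close> gives a \<open>q\<close> with \<open>q(c) = x^(m-1)\<close>.\<close>
    define q where "q = pcompose (monom 1 (m - 1)) [:- \<mu> / \<nu>, 1 / \<nu>:]"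
    have "pcompose [:- \<mu> / \<nu>, 1 / \<nu>:] c = [:0, 1:]"
      using \<mu>\<nu> by (simp add: pcompose_pCons)
    then have "pcompose q c = monom 1 (m - 1)"
      by (simp add: q_def pcompose_assoc[symmetric])
    then have "\<sigma> (monom 1 m * q) = c ^ m * monom 1 (m - 1)"
      using c[OF algs_ideal[OF A]] by (simp add: pcompose_mult pcompose_monom)
    moreover have "\<sigma> (monom 1 m * q) \<in> A"
      using Aut_K_bij[OF \<sigma>] algs_ideal[OF A] by (auto simp: bij_betw_def)
    ultimately have in_A: "c ^ m * monom 1 (m - 1) \<in> A" by simp
    obtain b r where r: "c ^ m = pCons b r" by (cases "c ^ m")
    have "b = \<mu> ^ m"
      using arg_cong[OF r, of "\<lambda>p. coeff p 0"] \<mu>\<nu> by (simp add: coeff_0_power)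
    \<comment> \<open>Apart from the constant term \<open>b\<close> of \<open>c ^ m\<close>, every
      term is pushed into the ideal and can be subtracted within \<open>A\<close>.\<close>
    have "c ^ m * monom 1 (m - 1) = smult b (monom 1 (m - 1)) + monom 1 m * r"
      unfolding r using m by (cases m) (simp_all add: monom_Suc)
    then have "smult b (monom 1 (m - 1)) \<in> A"
      using in_A algs_ideal[OF A, of r] algs_subspace[OF A]
      by (metis add_diff_cancel_right' poly_vs.subspace_diff)
    then have "smult (inverse b) (smult b (monom 1 (m - 1))) \<in> A"
      using algs_subspace[OF A] by (rule poly_vs.subspace_scale[rotated])
    then show False
      using algs_conductor[OF A] \<open>b = \<mu> ^ m\<close> \<open>\<mu> \<noteq> 0\<close> by simp
  qed
  then have "\<sigma> = restrict (t_aut \<nu>) A"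
    using c \<mu>\<nu> Aut_K_extensional[OF \<sigma>]
    by (auto simp: t_aut_def restrict_def extensional_def)
  then show "\<sigma> \<in> (\<lambda>t. restrict t A) ` torus"
    using \<mu>\<nu> by (auto simp: torus_def)
qed

lemma t_aut_inverse: "c \<noteq> 0 \<Longrightarrow> t_aut c (t_aut (inverse c) p) = p"
  by (intro poly_eqI) (simp add: t_aut_def coeff_pcompose_linear power_inverse)

lemma restrict_t_aut_in_Aut_K:
  assumes A: "A \<in> algs m" and stable: "\<And>c p. c \<noteq> 0 \<Longrightarrow> p \<in> A \<Longrightarrow> t_aut c p \<in> A" and "c \<noteq> 0"
  shows "restrict (t_aut c) A \<in> Aut_K A"
proof -
  \<comment> \<open>Stability under the inverse scalar supplies surjectivity.\<close>
  have "bij_betw (t_aut c) A A"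
    by (rule bij_betw_byWitness[where f' = "t_aut (inverse c)"])
      (use stable[of c] stable[of "inverse c"] \<open>c \<noteq> 0\<close>
        t_aut_inverse[of c] t_aut_inverse[of "inverse c"] in auto)
  then show ?thesis
    using algs_one[OF A] algs_mult[OF A] poly_vs.subspace_add[OF algs_subspace[OF A]]
      poly_vs.subspace_scale[OF algs_subspace[OF A]]
    by (auto simp: Aut_K_def t_aut_def pcompose_add pcompose_mult pcompose_smult pcompose_1
        cong: bij_betw_cong)
qed

section \<open>Monomial algebras\<close>

text \<open>The substitution only rescales coefficients, so it creates no new exponents, and
  membership in \<open>A\<close> depends on the exponents alone.\<close>

lemma monomial_algebra_imp_stable:
  assumes "monomial_algebra A" "p \<in> A"
  shows "t_aut c p \<in> A"
proof -
  from assms(1) obtain I where I: "poly_vs.span (monom 1 ` I) = A"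
    by (auto simp: monomial_algebra_def K_basis_def)
  have "p \<in> poly_vs.span (monom 1 ` I)" using assms(2) I by simp
  then have "i \<in> I" if "coeff p i \<noteq> 0" for i
    using that
  proof (induction rule: poly_vs.span_induct_alt)
    case (step a x y)
    then show ?case by (cases "coeff y i = 0") (auto split: if_splits)
  qed simp
  then have "t_aut c p \<in> poly_vs.span (monom 1 ` I)"
    by (intro in_span_monoms) (auto simp: t_aut_def coeff_pcompose_linear)
  then show ?thesis by (simp add: I)
qed

text \<open>If \<open>x\<^sup>i\<close> and \<open>x\<^sup>j\<close> both occur in \<open>p\<close>, then \<open>t\<^sub>c(p) - c\<^sup>j p\<close> has fewer terms and still
  contains \<open>x\<^sup>i\<close>, provided \<open>c\<^sup>i \<noteq> c\<^sup>j\<close>.\<close>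

lemma stable_imp_monom_mem:
  fixes A :: "'k::alg_closed_field poly set"
  assumes A: "poly_vs.subspace A" and stable: "\<And>c p. c \<noteq> 0 \<Longrightarrow> p \<in> A \<Longrightarrow> t_aut c p \<in> A"
    and "p \<in> A" "coeff p i \<noteq> 0"
  shows "monom 1 i \<in> A"
  using assms(3,4)
proof (induction "card {k. coeff p k \<noteq> 0}" arbitrary: p rule: less_induct)
  case less
  show ?case
  proof (cases "\<exists>j. j \<noteq> i \<and> coeff p j \<noteq> 0")
    case True
    then obtain j where j: "i \<noteq> j" "coeff p j \<noteq> 0" by metis
    obtain c :: 'k where c: "c \<noteq> 0" "c ^ i \<noteq> c ^ j"
      using exists_power_neq[OF j(1)] by blast
    define q where "q = t_aut c p - smult (c ^ j) p"
    have coeff_q: "coeff q k = (c ^ k - c ^ j) * coeff p k" for k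
      by (simp add: q_def t_aut_def coeff_pcompose_linear algebra_simps)
    have "q \<in> A"
      using A stable c less.prems
      by (auto simp: q_def intro: poly_vs.subspace_diff poly_vs.subspace_scale)
    moreover have "coeff q i \<noteq> 0" using c less.prems by (simp add: coeff_q)
    moreover have "card {k. coeff q k \<noteq> 0} < card {k. coeff p k \<noteq> 0}"
    proof (rule psubset_card_mono)
      show "finite {k. coeff p k \<noteq> 0}"
        by (rule finite_subset[of _ "{..degree p}"]) (auto simp: le_degree)
      show "{k. coeff q k \<noteq> 0} \<subset> {k. coeff p k \<noteq> 0}"
        using j by (auto simp: coeff_q)
    qed
    ultimately show ?thesis using less.hyps by blast
  next
    case False
    then have "p = smult (coeff p i) (monom 1 i)"
      by (intro poly_eqI) auto
    then have "monom 1 i = smult (inverse (coeff p i)) p"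
      using less.prems by (metis left_inverse smult_1_left smult_smult)
    then show ?thesis using A less.prems by (simp add: poly_vs.subspace_scale)
  qed
qed

text \<open>By stability every monomial occurring in an element of \<open>A\<close> lies in
  \<open>A\<close>, so \<open>gamma_set m A\<close> consists of the exponents strictly between 0 and
  \<open>m\<close> that occur in \<open>A\<close>.\<close>

lemma stable_imp_canonical_basis:
  fixes A :: "'k::alg_closed_field poly set"
  assumes m: "0 < m" and A: "A \<in> algs m"
    and stable: "\<And>c p. c \<noteq> 0 \<Longrightarrow> p \<in> A \<Longrightarrow> t_aut c p \<in> A"
  shows "is_canonical_basis m A (insert 1 (monom 1 ` gamma_set m A))"
proof -
  let ?\<Gamma> = "gamma_set m A"
  have monom: "monom 1 i \<in> A" if "p \<in> A" "coeff p i \<noteq> 0" for p i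
    using stable_imp_monom_mem[OF algs_subspace[OF A] stable] that by blast
  have B: "insert 1 (monom 1 ` ?\<Gamma>) = monom (1::'k) ` insert 0 ?\<Gamma>"
    by (simp add: monom_0 one_pCons)
  have \<Gamma>: "monom 1 \<gamma> \<in> A" "\<gamma> < m" if "\<gamma> \<in> ?\<Gamma>" for \<gamma>
    using that monom m by (auto simp: gamma_set_def lowest_term_def)
  have "poly_vs.span (monom 1 ` insert 0 ?\<Gamma>) = alg_bar m A"
  proof (rule poly_vs.span_subspace)
    show "monom 1 ` insert 0 ?\<Gamma> \<subseteq> alg_bar m A"
    proof clarify
      fix i assume "i \<in> insert 0 ?\<Gamma>"
      then have "monom 1 i \<in> A" "i < m"
        using \<Gamma> m algs_one[OF A] by (auto simp: monom_0 one_pCons[symmetric])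
      moreover from \<open>i < m\<close> have "monom 1 i mod monom 1 m = (monom 1 i :: 'k poly)"
        by (intro poly_eqI) (auto simp: coeff_mod_monom)
      ultimately show "monom 1 i \<in> alg_bar m A"
        unfolding alg_bar_def by (metis imageI)
    qed
    show "alg_bar m A \<subseteq> poly_vs.span (monom 1 ` insert 0 ?\<Gamma>)"
    proof (intro subsetI in_span_monoms)
      fix p i assume p: "p \<in> alg_bar m A" "coeff p i \<noteq> 0"
      then have "i < m"
        by (auto simp: alg_bar_def coeff_mod_monom split: if_splits)
      moreover have "monom 1 i \<in> A"
        using p alg_bar_subset[OF A] monom by blast
      ultimately show "i \<in> insert 0 ?\<Gamma>"
        by (auto simp: gamma_set_def lowest_term_def intro!: bexI[of _ "monom 1 i"])
    qed
    \<comment> \<open>As an intersection of two subspaces, the space of remainders is visibly a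
      subspace.\<close>
    have "alg_bar m A = A \<inter> {p. \<forall>i\<ge>m. coeff p i = 0}"
    proof (intro equalityI subsetI)
      fix p assume "p \<in> alg_bar m A"
      then show "p \<in> A \<inter> {p. \<forall>i\<ge>m. coeff p i = 0}"
        using alg_bar_subset[OF A] by (auto simp: alg_bar_def coeff_mod_monom)
    next
      fix p assume p: "p \<in> A \<inter> {p. \<forall>i\<ge>m. coeff p i = 0}"
      then have "p = p mod monom 1 m"
        by (intro poly_eqI) (auto simp: coeff_mod_monom)
      with p show "p \<in> alg_bar m A" by (auto simp: alg_bar_def)
    qed
    then show "poly_vs.subspace (alg_bar m A)"
      using algs_subspace[OF A] by (auto simp: poly_vs.subspace_def)
  qed
  then have "K_basis (insert 1 (monom 1 ` ?\<Gamma>)) (alg_bar m A)"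
    unfolding K_basis_def B using independent_monoms by blast
  then show ?thesis
    unfolding is_canonical_basis_def
    by (intro conjI exI[of _ "monom 1"] exI[of _ "\<lambda>_ _. 0"]) auto
qed

lemma canonical_basis_imp_monomial_algebra:
  assumes A: "A \<in> algs m" and B: "is_canonical_basis m A (insert 1 (monom 1 ` \<Gamma>))"
  shows "monomial_algebra A"
proof -
  \<comment> \<open>The exponents from \<open>m\<close> on restore the ideal that was divided
    out.\<close>
  let ?I = "insert 0 \<Gamma> \<union> {m..}"
  have eq: "insert 1 (monom 1 ` \<Gamma>) = monom (1::'a) ` insert 0 \<Gamma>"
    by (simp add: monom_0 one_pCons)
  have span: "poly_vs.span (monom 1 ` insert 0 \<Gamma>) = alg_bar m A"
    using B by (simp only: is_canonical_basis_def K_basis_def eq)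
  have "poly_vs.span (monom 1 ` ?I) = A"
  proof (rule poly_vs.span_subspace[OF _ _ algs_subspace[OF A]])
    have "monom 1 ` insert 0 \<Gamma> \<subseteq> A"
      using order_trans[OF poly_vs.span_superset alg_bar_subset[OF A, folded span]] .
    then show "monom 1 ` ?I \<subseteq> A" using algs_monom[OF A] by (auto simp del: insert_iff)
    show "A \<subseteq> poly_vs.span (monom 1 ` ?I)"
    proof
      fix p assume "p \<in> A"
      then have "p mod monom 1 m \<in> poly_vs.span (monom 1 ` insert 0 \<Gamma>)"
        unfolding span by (auto simp: alg_bar_def)
      then have "p mod monom 1 m \<in> poly_vs.span (monom 1 ` ?I)"
        by (rule rev_subsetD[OF _ poly_vs.span_mono]) blast
      moreover have "monom 1 m * (p div monom 1 m) \<in> poly_vs.span (monom 1 ` ?I)"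
        by (rule in_span_monoms) (auto simp: coeff_monom_mult split: if_splits)
      ultimately have "monom 1 m * (p div monom 1 m) + p mod monom 1 m \<in> poly_vs.span (monom 1 ` ?I)"
        by (intro poly_vs.span_add)
      then show "p \<in> poly_vs.span (monom 1 ` ?I)" by simp
    qed
  qed
  then show ?thesis
    unfolding monomial_algebra_def K_basis_def using independent_monoms by blast
qed

theorem corollary3p5:
  fixes A :: "'k::alg_closed_field poly set" and m :: nat and \<Gamma> :: "nat set"
  assumes "m \<ge> 2" and "A \<in> algs_of m \<Gamma>"
  shows "(monomial_algebra A \<longleftrightarrow> Aut_K A = (\<lambda>t. restrict t A) ` torus) \<and>
         (Aut_K A = (\<lambda>t. restrict t A) ` torus \<longleftrightarrow> is_canonical_basis m A (insert 1 (monom 1 ` \<Gamma>)))"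
proof -
  from assms have m: "0 < m" and A: "A \<in> algs m" and \<Gamma>: "gamma_set m A = \<Gamma>"
    by (auto simp: algs_of_def)
  have "Aut_K A = (\<lambda>t. restrict t A) ` torus" if "monomial_algebra A"
    using Aut_K_subset_torus[OF m A]
      restrict_t_aut_in_Aut_K[OF A monomial_algebra_imp_stable[OF that]]
    by (auto simp: torus_def)
  moreover have "is_canonical_basis m A (insert 1 (monom 1 ` \<Gamma>))"
    if Aut: "Aut_K A = (\<lambda>t. restrict t A) ` torus"
  proof -
    \<comment> \<open>Each restricted torus element is an automorphism of \<open>A\<close> by
      assumption, so it maps \<open>A\<close> into itself.\<close>
    have "t_aut c p \<in> A" if "c \<noteq> 0" "p \<in> A" for c p
    proof -
      have "restrict (t_aut c) A \<in> Aut_K A"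
        unfolding Aut using \<open>c \<noteq> 0\<close> by (auto simp: torus_def)
      from Aut_K_bij[OF this] \<open>p \<in> A\<close> show ?thesis
        by (auto dest: bij_betwE)
    qed
    then show ?thesis using stable_imp_canonical_basis[OF m A] \<Gamma> by blast
  qed
  moreover note canonical_basis_imp_monomial_algebra[OF A]
  ultimately show ?thesis by blast
qed

end
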